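(* Let $d,n$ be integers with $d\geq1$ and $n\geq1$. (1) If $n\leq d$, then $\mathrm{gp}^3_d(P_n\,\Box\,P_2)=2$ if $n=1$, and $\mathrm{gp}^3_d(P_n\,\Box\,P_2)=\min(n,3)$ if $n\geq2$. (2) If $n\geq d+1$, then $\mathrm{gp}^3_d(P_n\,\Box\,P_2)=2\lfloor n/2\rfloor+2\min(n\bmod 2,1)$ if $d=2$, and $\mathrm{gp}^3_d(P_n\,\Box\,P_2)=3\lfloor n/d\rfloor+\min(n\bmod d,3)$ if $d\geq3$.
   Context: $P_n\,\Box\,P_2$ is the grid with vertex set $\{1,\ldots,n\}\times\{1,2\}$, where $(i,j)$ and $(i',j')$ are adjacent iff either $j=j'$ and $|i-i'|=1$, or $i=i'$ and $j\neq j'$. For a graph $G$, a geodesic is a shortest path between two vertices; its length $\lambda(g)$ is its number of edges. For $d\ge1$, $k\ge2$, $S\subseteq V(G)$ is a $k$-general $d$-position set if every geodesic $g$ with $|S\cap V(g)|\geq k$ has $\lambda(g)>d$; $\mathrm{gp}^k_d(G)$ is the largest cardinality of such a set. *)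

theory Defs
  imports "Graph_Theory.Graph_Theory"
begin

text \<open>
  A simple graph is a \<open>pair_graph\<close>: a finite loopfree digraph whose arc set is symmetric,
  so each undirected edge is represented by its two orientations.  A walk is given by its list
  of vertices, and \<open>vwalk_length\<close> counts edges, not vertices.
\<close>

definition geodesic :: "'a list \<Rightarrow> 'a pair_pre_digraph \<Rightarrow> bool" where
  "geodesic g G \<longleftrightarrow> vpath g (with_proj G) \<and>
     (\<forall>q. vpath q (with_proj G) \<and> hd q = hd g \<and> last q = last g
        \<longrightarrow> vwalk_length g \<le> vwalk_length q)"

definition general_position :: "nat \<Rightarrow> nat \<Rightarrow> 'a pair_pre_digraph \<Rightarrow> 'a set \<Rightarrow> bool" where
  "general_position k d G S \<longleftrightarrow> S \<subseteq> pverts G \<and>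
     (\<forall>g. geodesic g G \<and> k \<le> card (S \<inter> set g) \<longrightarrow> d < vwalk_length g)"

text \<open>
  The maximum is over a finite set whenever \<open>G\<close> is finite, and over a nonempty one whenever
  \<open>k\<close> is positive, since the empty set is then a general position set.
\<close>

definition gp :: "nat \<Rightarrow> nat \<Rightarrow> 'a pair_pre_digraph \<Rightarrow> nat" where
  "gp k d G = Max (card ` {S. general_position k d G S})"

text \<open>The grid \<open>P\<^sub>n \<box> P\<^sub>2\<close>; the distance of first coordinates is taken in the integers,
  as subtraction of naturals truncates.\<close>

definition ladder :: "nat \<Rightarrow> (nat \<times> nat) pair_pre_digraph" where
  "ladder n =
     \<lparr> pverts = {1..n} \<times> {1, 2},
       parcs = {((i, j), (i', j')).
          (i, j) \<in> {1..n} \<times> {1, 2} \<and> (i', j') \<in> {1..n} \<times> {1, 2} \<and>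
          (j = j' \<and> \<bar>int i - int i'\<bar> = 1 \<or> i = i' \<and> j \<noteq> j')} \<rparr>"

lemma pair_graph_ladder: "pair_graph (ladder n)"
proof -
  have sub: "parcs (ladder n) \<subseteq> pverts (ladder n) \<times> pverts (ladder n)"
    by (clarsimp simp: ladder_def)
  then have sub_fst: "fst e \<in> pverts (ladder n)" and sub_snd: "snd e \<in> pverts (ladder n)"
    if "e \<in> parcs (ladder n)" for e
    using that by (auto simp: mem_Times_iff dest: subsetD)
  have fin: "finite (pverts (ladder n))"
    by (simp add: ladder_def)
  have fin': "finite (parcs (ladder n))"
    by (rule finite_subset[OF sub]) (simp add: fin)
  have sym: "sym (parcs (ladder n))"
    by (rule symI) (clarsimp simp: ladder_def abs_minus_commute, metis)
  have irr: "fst e \<noteq> snd e" if "e \<in> parcs (ladder n)" for e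
    using that by (cases e) (clarsimp simp: ladder_def)
  show ?thesis
    by unfold_locales (use sub_fst sub_snd fin fin' sym irr in \<open>simp_all add: symmetric_def\<close>)
qed

lemma gp_attained:
  assumes "finite (pverts G)" and "0 < k"
  shows "\<exists>S. general_position k d G S \<and> card S = gp k d G"
    and "general_position k d G S \<Longrightarrow> card S \<le> gp k d G"
proof -
  have fin: "finite {S. general_position k d G S}"
    by (rule finite_subset[of _ "Pow (pverts G)"])
      (use assms(1) in \<open>auto simp: general_position_def\<close>)
  have "general_position k d G {}"
    using assms(2) by (simp add: general_position_def)
  then have ne: "{S. general_position k d G S} \<noteq> {}" by blast
  show "\<exists>S. general_position k d G S \<and> card S = gp k d G"
    proof -
    have "gp k d G \<in> card ` {S. general_position k d G S}"
      unfolding gp_def by (rule Max_in) (use fin ne in simp_all)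
    then show ?thesis by (metis (no_types, lifting) imageE mem_Collect_eq)
  qed
  show "general_position k d G S \<Longrightarrow> card S \<le> gp k d G"
    using fin by (auto simp: gp_def)
qed

end

theory Submission
  imports Defs
begin

text \<open>
  Three vertices lie on a common geodesic exactly when the distance function is additive along
  them, so the problem concerns triples in \<open>S\<close> on which the distance of the ladder is additive
  with total at most \<open>d\<close>.

  Upper bound: two vertices in \<open>d\<close> consecutive columns have distance at most \<open>d\<close>, and among four
  vertices in these columns some three lie on a geodesic; so \<open>d\<close> consecutive columns contain at
  most three elements of \<open>S\<close>.  A column contained in \<open>S\<close> excludes all other elements at column
  distance less than \<open>d\<close>, which settles the remainders 1 and 2.

  Lower bound: for \<open>d = 2\<close> take all vertices in the odd columns; for \<open>d \<ge> 3\<close> take one vertex in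
  each of the first three columns of every block of \<open>d\<close> columns, alternating between the rows.
\<close>

section \<open>Geodesics and graph distance\<close>

lemma vwalk_nth_arc:
  assumes "vwalk p G" and "Suc i < length p"
  shows "(p ! i, p ! Suc i) \<in> arcs_ends G"
  using assms
proof (induction arbitrary: i)
  case (Base u)
  then show ?case by simp
next
  case (Cons u v es)
  then show ?case by (cases i) simp_all
qed

text \<open>These conditions pin down the graph distance without a minimum over walks: the triangle
  inequality and \<open>dist_arc\<close> bound \<open>dist\<close> by the length of any walk, and
  \<open>dist_step\<close> builds a walk attaining it.\<close>

locale graph_distance =
  fixes G :: "'a pair_pre_digraph" and dist :: "'a \<Rightarrow> 'a \<Rightarrow> nat"
  assumes arcs_in_verts: "(u, v) \<in> parcs G \<Longrightarrow> u \<in> pverts G \<and> v \<in> pverts G"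
    and dist_self: "dist u u = 0"
    and dist_triangle: "dist u w \<le> dist u v + dist v w"
    and dist_arc: "(u, v) \<in> parcs G \<Longrightarrow> dist u v \<le> 1"
    and dist_step: "u \<in> pverts G \<Longrightarrow> v \<in> pverts G \<Longrightarrow> u \<noteq> v \<Longrightarrow>
      \<exists>w. (u, w) \<in> parcs G \<and> dist u v = Suc (dist w v)"
begin

lemma dist_nth_le:
  assumes "vwalk p (with_proj G)" and "i \<le> j" and "j < length p"
  shows "dist (p ! i) (p ! j) \<le> j - i"
  using assms(2,3)
proof (induction j rule: dec_induct)
  case base
  then show ?case by (simp add: dist_self)
next
  case (step j)
  have "dist (p ! j) (p ! Suc j) \<le> 1"
    using vwalk_nth_arc[OF assms(1) step.prems] dist_arc by simp
  with step dist_triangle[of "p ! i" "p ! Suc j" "p ! j"] show ?case by simp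
qed

lemma dist_le_vwalk_length:
  assumes "vwalk p (with_proj G)"
  shows "dist (hd p) (last p) \<le> vwalk_length p"
proof -
  from assms have "p \<noteq> []" by auto
  with dist_nth_le[OF assms, of 0 "length p - 1"] show ?thesis
    by (simp add: hd_conv_nth last_conv_nth)
qed

text \<open>Splitting the end-to-end distance at positions \<open>i\<close> and \<open>j\<close>,
  the outer pieces contribute at most \<open>i\<close> and \<open>length p - 1 - j\<close>, so the
  middle piece must account for the remaining \<open>j - i\<close>.\<close>

lemma dist_nth_eq:
  assumes p: "vwalk p (with_proj G)" and len: "vwalk_length p = dist (hd p) (last p)"
    and ij: "i \<le> j" "j < length p"
  shows "dist (p ! i) (p ! j) = j - i"
proof -
  let ?k = "length p - 1"
  have "p \<noteq> []" using p by auto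
  then have "?k = dist (p ! 0) (p ! ?k)"
    using len by (simp add: hd_conv_nth last_conv_nth)
  also have "\<dots> \<le> dist (p ! 0) (p ! i) + dist (p ! i) (p ! ?k)"
    by (rule dist_triangle)
  also have "\<dots> \<le> dist (p ! 0) (p ! i) + (dist (p ! i) (p ! j) + dist (p ! j) (p ! ?k))"
    by (intro add_left_mono dist_triangle)
  also have "\<dots> \<le> (i - 0) + (dist (p ! i) (p ! j) + (?k - j))"
  proof (intro add_mono order_refl)
    show "dist (p ! 0) (p ! i) \<le> i - 0" by (rule dist_nth_le[OF p]) (use ij in simp_all)
    show "dist (p ! j) (p ! ?k) \<le> ?k - j" by (rule dist_nth_le[OF p]) (use ij in simp_all)
  qed
  finally show ?thesis
    using dist_nth_le[OF p ij] ij by linarith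
qed

lemma shortest_vwalk_through:
  assumes "u \<in> pverts G" "v \<in> pverts G" "w \<in> pverts G"
  shows "\<exists>p. vwalk p (with_proj G) \<and> hd p = u \<and> last p = w \<and> v \<in> set p \<and>
    vwalk_length p = dist u v + dist v w"
proof -
  \<comment> \<open>A shortest walk from \<open>x\<close> to \<open>y\<close> is put in front of
    \<open>q\<close>; \<open>A\<close> remembers vertices of \<open>q\<close> that must survive. The
    first use starts from the one-vertex walk at \<open>w\<close>, the second has
    \<open>A = {v}\<close>.\<close>
  have extend: "\<exists>p. vwalk p (with_proj G) \<and> hd p = x \<and> last p = w \<and> A \<subseteq> set p \<and>
      vwalk_length p = dist x y + m"
    if y: "y \<in> pverts G" and x: "x \<in> pverts G"
      and q: "vwalk q (with_proj G)" "hd q = y" "last q = w" "A \<subseteq> set q" "vwalk_length q = m"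
    for A m q x y
    using x
  proof (induction "dist x y" arbitrary: x)
    case 0
    then have "x = y" using dist_step y by fastforce
    with q 0 show ?case by force
  next
    case (Suc k)
    then have "x \<noteq> y" using dist_self by auto
    with Suc.prems y obtain z where z: "(x, z) \<in> parcs G" "dist x y = Suc (dist z y)"
      using dist_step by blast
    then have "z \<in> pverts G" "k = dist z y"
      using arcs_in_verts Suc.hyps(2) by auto
    with Suc.hyps(1) obtain p where p: "vwalk p (with_proj G)" "hd p = z" "last p = w"
      "A \<subseteq> set p" "vwalk_length p = dist z y + m" by blast
    then have "p \<noteq> []" by auto
    moreover have "vwalk (x # p) (with_proj G)"
      using p z Suc.prems by (intro vwalk_consI) auto
    ultimately show ?case
      using p z by (intro exI[of _ "x # p"]) (cases p; auto)
  qed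
  have "vwalk [w] (with_proj G)" using assms by (auto simp: vwalk_def)
  from extend[OF assms(3,2) this, of "{}"] obtain q where
    q: "vwalk q (with_proj G)" "hd q = v" "last q = w" "vwalk_length q = dist v w"
    by auto
  have "{v} \<subseteq> set q" using q by (cases q) auto
  from extend[OF assms(2,1) q(1-3) this q(4)] show ?thesis by blast
qed

text \<open>Geodesics minimise over paths, the distance over walks. The two agree because a walk as
  long as the distance repeats no vertex: different positions on it are at positive
  distance.\<close>

lemma geodesic_iff:
  "geodesic g G \<longleftrightarrow> vwalk g (with_proj G) \<and> vwalk_length g = dist (hd g) (last g)"
proof -
  have vpath: "vpath p (with_proj G)"
    if "vwalk p (with_proj G)" "vwalk_length p = dist (hd p) (last p)" for p
  proof (rule vpathI[OF that(1)])
    have "p ! i \<noteq> p ! j" if "i < j" "j < length p" for i j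
      using dist_nth_eq[OF \<open>vwalk p _\<close> \<open>_ = dist _ _\<close>, of i j] that dist_self[of "p ! i"]
      by auto
    then show "distinct p"
      by (metis distinct_conv_nth linorder_neqE_nat)
  qed
  show ?thesis
  proof
    assume g: "geodesic g G"
    then have walk: "vwalk g (with_proj G)" by (auto simp: geodesic_def)
    then have "hd g \<in> pverts G" "last g \<in> pverts G" by (auto simp: vwalk_def)
    from shortest_vwalk_through[OF this(1,1,2)] obtain p where
      p: "vwalk p (with_proj G)" "hd p = hd g" "last p = last g"
      "vwalk_length p = dist (hd g) (last g)"
      by (auto simp: dist_self)
    then have "vpath p (with_proj G)" using vpath by simp
    with g p have "vwalk_length g \<le> vwalk_length p" by (auto simp: geodesic_def)
    with p(4) dist_le_vwalk_length[OF walk] walk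
    show "vwalk g (with_proj G) \<and> vwalk_length g = dist (hd g) (last g)" by simp
  next
    assume g: "vwalk g (with_proj G) \<and> vwalk_length g = dist (hd g) (last g)"
    then have "vwalk_length g \<le> vwalk_length q"
      if "vpath q (with_proj G) \<and> hd q = hd g \<and> last q = last g" for q
      using that dist_le_vwalk_length[of q] by (auto simp: vpath_def)
    then show "geodesic g G" using g vpath by (auto simp: geodesic_def)
  qed
qed

lemma general_position_3_iff:
  "general_position 3 d G S \<longleftrightarrow> S \<subseteq> pverts G \<and>
    (\<forall>u\<in>S. \<forall>v\<in>S. \<forall>w\<in>S. u \<noteq> v \<and> v \<noteq> w \<and> u \<noteq> w \<and> dist u v + dist v w = dist u w
      \<longrightarrow> d < dist u w)"
  (is "?L \<longleftrightarrow> ?R")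
proof
  assume L: ?L
  then have sub: "S \<subseteq> pverts G" by (simp add: general_position_def)
  moreover have "d < dist u w"
    if S: "u \<in> S" "v \<in> S" "w \<in> S" and ne: "u \<noteq> v" "v \<noteq> w" "u \<noteq> w"
      and add: "dist u v + dist v w = dist u w" for u v w
  proof -
    obtain p where p: "vwalk p (with_proj G)" "hd p = u" "last p = w" "v \<in> set p"
      "vwalk_length p = dist u w"
      using shortest_vwalk_through[of u v w] S sub add by auto
    then have "geodesic p G" by (simp add: geodesic_iff)
    moreover have "p \<noteq> []" using p by auto
    then have "{u, v, w} \<subseteq> S \<inter> set p" using p S by auto
    then have "card {u, v, w} \<le> card (S \<inter> set p)" by (intro card_mono) auto
    ultimately have "d < vwalk_length p" using L ne by (simp add: general_position_def)
    then show ?thesis using p by simp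
  qed
  ultimately show ?R by blast
next
  assume R: ?R
  have "d < vwalk_length g" if g: "geodesic g G" and c: "3 \<le> card (S \<inter> set g)" for g
  proof -
    have walk: "vwalk g (with_proj G)" and len: "vwalk_length g = dist (hd g) (last g)"
      using g by (auto simp: geodesic_iff)
    \<comment> \<open>Working with positions on \<open>g\<close> orders the three elements of
      \<open>S\<close>; along a geodesic distances are differences of positions, hence
      additive.\<close>
    define I where "I = {i. i < length g \<and> g ! i \<in> S}"
    have "S \<inter> set g \<subseteq> (!) g ` I" by (auto simp: I_def in_set_conv_nth)
    then have "3 \<le> card I"
      using c card_mono[of "(!) g ` I" "S \<inter> set g"] card_image_le[of I "(!) g"]
      by (simp add: I_def)
    then obtain T where T: "T \<subseteq> I" "card T = 3" by (metis obtain_subset_with_card_n)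
    then obtain a b c where abc: "T = {a, b, c}" "a \<noteq> b" "b \<noteq> c" "a \<noteq> c"
      by (auto simp: card_3_iff)
    have "\<exists>i j k. i \<in> T \<and> j \<in> T \<and> k \<in> T \<and> i < j \<and> j < k"
      using abc by (metis insert_iff linorder_neqE_nat)
    then obtain i j k where ijk: "i < j" "j < k" and I: "i \<in> I" "j \<in> I" "k \<in> I"
      using T(1) by blast
    then have k: "k < length g" by (simp add: I_def)
    have eq: "dist (g ! x) (g ! y) = y - x" if "x \<le> y" "y \<le> k" for x y
      using dist_nth_eq[OF walk len, of x y] that k by simp
    have "g ! x \<noteq> g ! y" if "x < y" "y \<le> k" for x y
      using eq[of x y] that dist_self[of "g ! x"] by auto
    then have "g ! i \<noteq> g ! j" "g ! j \<noteq> g ! k" "g ! i \<noteq> g ! k"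
      using ijk by auto
    moreover have "dist (g ! i) (g ! j) + dist (g ! j) (g ! k) = dist (g ! i) (g ! k)"
      using ijk eq by simp
    moreover have "g ! i \<in> S" "g ! j \<in> S" "g ! k \<in> S"
      using I by (simp_all add: I_def)
    ultimately have "d < dist (g ! i) (g ! k)" using R by blast
    with eq[of i k] ijk k show ?thesis by simp
  qed
  with R show ?L by (simp add: general_position_def)
qed

end

section \<open>General position in the ladder\<close>

text \<open>Truncated subtraction makes one of the two differences zero, so their sum is the
  absolute difference; on rows 1 and 2 this is the Manhattan distance.\<close>

fun ladder_dist :: "nat \<times> nat \<Rightarrow> nat \<times> nat \<Rightarrow> nat" where
  "ladder_dist (i, j) (i', j') = (i - i') + (i' - i) + (if j = j' then 0 else 1)"

interpretation ladder: graph_distance "ladder n" ladder_dist for n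
proof
  fix u v :: "nat \<times> nat"
  show "u \<in> pverts (ladder n) \<and> v \<in> pverts (ladder n)" if "(u, v) \<in> parcs (ladder n)"
    using that by (auto simp: ladder_def)
  show "ladder_dist u u = 0" by (cases u) simp
  show "ladder_dist u v \<le> 1" if "(u, v) \<in> parcs (ladder n)"
    using that by (cases u; cases v) (auto simp: ladder_def)
  show "ladder_dist u w \<le> ladder_dist u v + ladder_dist v w" for w
  proof -
    obtain a i b j c k where eq: "u = (a, i)" "v = (b, j)" "w = (c, k)"
      by (metis surj_pair)
    have "(a - c) + (c - a) \<le> ((a - b) + (b - a)) + ((b - c) + (c - b))"
      by linarith
    moreover have "(if i = k then 0 else 1)
        \<le> (if i = j then 0 else 1) + (if j = k then 0 else (1::nat))" by auto
    ultimately show ?thesis unfolding eq ladder_dist.simps by linarith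
  qed
  show "\<exists>w. (u, w) \<in> parcs (ladder n) \<and> ladder_dist u v = Suc (ladder_dist w v)"
    if u: "u \<in> pverts (ladder n)" and v: "v \<in> pverts (ladder n)" and "u \<noteq> v"
  proof -
    obtain i j i' j' where eq: "u = (i, j)" "v = (i', j')" by (cases u; cases v)
    \<comment> \<open>The neighbour one step closer is found by moving along the row first and
      changing rows only in the target column.\<close>
    consider "i < i'" | "i' < i" | "i = i'" "j \<noteq> j'" using eq \<open>u \<noteq> v\<close> by fastforce
    then show ?thesis
    proof cases
      case 1
      then show ?thesis using u v eq by (intro exI[of _ "(Suc i, j)"]) (auto simp: ladder_def)
    next
      case 2
      then show ?thesis using u v eq by (intro exI[of _ "(i - 1, j)"]) (auto simp: ladder_def)
    next
      case 3
      then show ?thesis using u v eq by (intro exI[of _ v]) (auto simp: ladder_def)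
    qed
  qed
qed

lemma gp_ladder_eqI:
  assumes "general_position 3 d (ladder n) S" and "card S = m"
    and "\<And>S. general_position 3 d (ladder n) S \<Longrightarrow> card S \<le> m"
  shows "gp 3 d (ladder n) = m"
proof -
  have fin: "finite (pverts (ladder n))" by (simp add: ladder_def)
  show ?thesis
    using gp_attained(1)[OF fin, of 3 d] gp_attained(2)[OF fin, of 3 d S] assms
    by (metis le_antisym zero_less_numeral)
qed

text \<open>A single column is exceptional: with only two vertices it has no triples, whereas the
  formula for \<open>d \<ge> 3\<close> would give 1.\<close>

lemma gp_ladder_1: "gp 3 d (ladder 1) = 2"
proof (rule gp_ladder_eqI)
  have verts: "pverts (ladder 1) = {(1, 1), (1, 2)}" by (auto simp: ladder_def)
  show "general_position 3 d (ladder 1) {(1, 1), (1, 2)}"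
    unfolding ladder.general_position_3_iff verts by auto
  show "card {(1::nat, 1::nat), (1, 2)} = 2" by simp
  show "card S \<le> 2" if "general_position 3 d (ladder 1) S" for S
  proof -
    have "S \<subseteq> {(1, 1), (1, 2)}" using that verts by (simp add: general_position_def)
    from card_mono[OF _ this] show ?thesis by simp
  qed
qed

section \<open>Upper bounds\<close>

locale ladder_position =
  fixes d n :: nat and S :: "(nat \<times> nat) set"
  assumes general_position: "general_position 3 d (ladder n) S" and d_ge_2: "2 \<le> d"
begin

lemma in_ladder: "v \<in> S \<Longrightarrow> 1 \<le> fst v \<and> fst v \<le> n \<and> (snd v = 1 \<or> snd v = 2)"
  using general_position by (auto simp: general_position_def ladder_def)

lemma finite_S: "finite S"
  using general_position
  by (auto simp: general_position_def ladder_def intro: finite_subset)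

lemma no_short_triple:
  assumes "u \<in> S" "v \<in> S" "w \<in> S" "u \<noteq> v" "v \<noteq> w" "u \<noteq> w"
    and "ladder_dist u v + ladder_dist v w = ladder_dist u w"
  shows "d < ladder_dist u w"
  using general_position assms unfolding ladder.general_position_3_iff by blast

text \<open>Half-open windows fit together without overlap. Columns are numbered from 1, so column
  \<open>Suc a\<close> alone is the window from \<open>a\<close> to \<open>Suc a\<close>.\<close>

definition columns :: "nat \<Rightarrow> nat \<Rightarrow> nat" where
  "columns a b = card {v \<in> S. a < fst v \<and> fst v \<le> b}"

lemma columns_split: "a \<le> b \<Longrightarrow> b \<le> c \<Longrightarrow> columns a c \<le> columns a b + columns b c"
  unfolding columns_def
  by (rule order_trans[OF card_mono card_Un_le]) (auto simp: finite_S)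

lemma card_S: "card S = columns 0 n"
  unfolding columns_def using in_ladder by (intro arg_cong[where f = card]) force

lemma columns_eq_0I: "(\<And>v. v \<in> S \<Longrightarrow> \<not> (a < fst v \<and> fst v \<le> b)) \<Longrightarrow> columns a b = 0"
  unfolding columns_def by (subst card_eq_0_iff) blast

lemma column_le_2: "columns a (Suc a) \<le> 2"
proof -
  have "{v \<in> S. a < fst v \<and> fst v \<le> Suc a} \<subseteq> {(Suc a, 1), (Suc a, 2)}"
    using in_ladder by (force simp: le_less_Suc_eq)
  from card_mono[OF _ this] show ?thesis unfolding columns_def by simp
qed

lemma full_column_isolated:
  assumes "(a, 1) \<in> S" "(a, 2) \<in> S" and "v \<in> S" "fst v \<noteq> a"
  shows "fst v + d \<le> a \<or> a + d \<le> fst v"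
proof -
  obtain i j where v: "v = (i, j)" by (cases v)
  then have j: "j = 1 \<or> j = 2" using in_ladder[OF assms(3)] by simp
  \<comment> \<open>\<open>3 - j\<close> is the row other than that of \<open>v\<close>: a shortest
    route from there to \<open>v\<close> can change rows first and so pass through
    \<open>(a, j)\<close>.\<close>
  have "d < ladder_dist (a, 3 - j) v"
    using assms v j by (intro no_short_triple[of _ "(a, j)"]) auto
  with v j show ?thesis by auto
qed

lemma full_columnI:
  assumes "columns a (Suc a) = 2"
  shows "(Suc a, 1) \<in> S" "(Suc a, 2) \<in> S"
proof -
  have sub: "{v \<in> S. a < fst v \<and> fst v \<le> Suc a} \<subseteq> {(Suc a, 1), (Suc a, 2)}"
    using in_ladder by (force simp: le_less_Suc_eq)
  have "{v \<in> S. a < fst v \<and> fst v \<le> Suc a} = {(Suc a, 1), (Suc a, 2)}"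
    by (rule card_subset_eq[OF _ sub]) (use assms in \<open>simp_all add: columns_def\<close>)
  then show "(Suc a, 1) \<in> S" "(Suc a, 2) \<in> S" by auto
qed

text \<open>Since \<open>d \<ge> 2\<close>, a full column forces the adjacent one to be empty;
  otherwise each holds at most one element.\<close>

lemma two_columns_le_2: "columns a (a + 2) \<le> 2"
proof -
  have split: "columns a (a + 2) \<le> columns a (Suc a) + columns (Suc a) (Suc (Suc a))"
    using columns_split[of a "Suc a" "a + 2"] by simp
  have "columns (Suc a) (Suc (Suc a)) = 0" if "columns a (Suc a) = 2"
  proof -
    have "\<not> (Suc a < fst v \<and> fst v \<le> Suc (Suc a))" if "v \<in> S" for v
      using full_column_isolated[OF full_columnI[OF \<open>_ = 2\<close>] that] d_ge_2 by auto
    then show ?thesis by (rule columns_eq_0I)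
  qed
  moreover have "columns a (Suc a) = 0" if "columns (Suc a) (Suc (Suc a)) = 2"
  proof -
    have "\<not> (a < fst v \<and> fst v \<le> Suc a)" if "v \<in> S" for v
      using full_column_isolated[OF full_columnI[OF \<open>_ = 2\<close>] that] d_ge_2 by auto
    then show ?thesis by (rule columns_eq_0I)
  qed
  ultimately show ?thesis
    using split column_le_2[of a] column_le_2[of "Suc a"] by linarith
qed

lemma columns_le_3:
  assumes "b \<le> a + d"
  shows "columns a b \<le> 3"
proof -
  define R where "R j = {i. a < i \<and> i \<le> b \<and> (i, j) \<in> S}" for j
  have fin: "finite (R j)" for j
    by (rule finite_subset[of _ "{..b}"]) (auto simp: R_def)
  \<comment> \<open>Column distance within the window is at most \<open>d - 1\<close> and a row
    change adds at most 1, so every additive triple with both ends in it is forbidden.\<close>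
  have no: False
    if "(x, j) \<in> S" "(y, k) \<in> S" "(z, l) \<in> S" "a < x" "x \<le> b" "a < z" "z \<le> b"
      "(x, j) \<noteq> (y, k)" "(y, k) \<noteq> (z, l)" "(x, j) \<noteq> (z, l)"
      "ladder_dist (x, j) (y, k) + ladder_dist (y, k) (z, l) = ladder_dist (x, j) (z, l)"
    for x y z j k l
    using no_short_triple[OF that(1-3) that(8-11)] that(4-7) assms by (auto split: if_splits)
  have row: "card (R j) \<le> 2" for j
  proof (rule ccontr)
    assume "\<not> card (R j) \<le> 2"
    then obtain T where T: "T \<subseteq> R j" "card T = 3"
      by (metis not_less_eq_eq numeral_2_eq_2 numeral_3_eq_3 obtain_subset_with_card_n)
    then obtain x y z where "T = {x, y, z}" "x \<noteq> y" "y \<noteq> z" "x \<noteq> z"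
      by (auto simp: card_3_iff)
    then have "\<exists>x y z. x \<in> T \<and> y \<in> T \<and> z \<in> T \<and> x < y \<and> y < z"
      by (metis insert_iff linorder_neqE_nat)
    then obtain x y z where "x \<in> R j" "y \<in> R j" "z \<in> R j" "x < y" "y < z"
      using T(1) by blast
    then show False using no[of x j y j z j] by (simp add: R_def)
  qed
  \<comment> \<open>If \<open>z\<close> were not strictly between \<open>x\<close> and
    \<open>y\<close>, the nearer of the two vertices in row \<open>j\<close> would lie on a geodesic
    from the other one to \<open>(z, k)\<close>.\<close>
  have between: "x < z \<and> z < y"
    if "x \<in> R j" "y \<in> R j" "z \<in> R k" "x < y" "j \<noteq> k" for x y z j k
  proof (rule ccontr)
    assume "\<not> (x < z \<and> z < y)"
    then consider "z \<le> x" | "y \<le> z" by linarith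
    then show False
    proof cases
      case 1
      then show False using no[of z k x j y j] that by (auto simp: R_def)
    next
      case 2
      then show False using no[of x j y j z k] that by (auto simp: R_def)
    qed
  qed
  have two: "\<exists>x y. x \<in> R j \<and> y \<in> R j \<and> x < y" if "card (R j) = 2" for j
    using that unfolding card_2_iff by (metis insert_iff linorder_neqE_nat)
  \<comment> \<open>With two elements in each row, each pair would have to lie strictly inside the
    other.\<close>
  have "\<not> (card (R 1) = 2 \<and> card (R 2) = 2)"
  proof
    assume "card (R 1) = 2 \<and> card (R 2) = 2"
    then obtain x y z w where "x \<in> R 1" "y \<in> R 1" "x < y" "z \<in> R 2" "w \<in> R 2" "z < w"
      using two by meson
    then have "x < z" "z < x"
      using between[of x 1 y z 2] between[of z 2 w x 1] by auto
    then show False by simp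
  qed
  then have "card (R 1) + card (R 2) \<le> 3"
    using row[of 1] row[of 2] by linarith
  moreover have "{v \<in> S. a < fst v \<and> fst v \<le> b}
      \<subseteq> (\<lambda>i. (i, 1)) ` R 1 \<union> (\<lambda>i. (i, 2)) ` R 2"
    using in_ladder by (force simp: R_def)
  then have "columns a b \<le> card ((\<lambda>i. (i, 1::nat)) ` R 1 \<union> (\<lambda>i. (i, 2)) ` R 2)"
    unfolding columns_def by (intro card_mono) (auto simp: fin)
  moreover have "\<dots> \<le> card (R 1) + card (R 2)"
    by (rule order_trans[OF card_Un_le]) (intro add_mono card_image_le fin)
  ultimately show ?thesis by linarith
qed

section \<open>Adding up the window bounds over blocks of columns\<close>

lemma columns_blocks_le:
  assumes "\<And>a. columns a (a + k) \<le> m"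
  shows "columns 0 (q * k) \<le> m * q"
proof (induction q)
  case 0
  have "columns 0 0 = 0" by (rule columns_eq_0I) linarith
  then show ?case by simp
next
  case (Suc q)
  then show ?case
    using columns_split[of 0 "q * k" "q * k + k"] assms[of "q * k"] by (simp add: add.commute)
qed

lemma card_le_pairs: "card S \<le> 2 * ((n + 1) div 2)"
proof -
  have blocks: "columns 0 (n div 2 * 2) \<le> 2 * (n div 2)"
    by (rule columns_blocks_le) (rule two_columns_le_2)
  show ?thesis
  proof (cases "even n")
    case True
    then show ?thesis using blocks card_S by auto
  next
    case False
    then have n: "n = Suc (n div 2 * 2)" by presburger
    have "columns 0 n \<le> 2 * (n div 2) + 2"
      using blocks columns_split[of 0 "n div 2 * 2" "Suc (n div 2 * 2)"]
        column_le_2[of "n div 2 * 2"] by (subst n) linarith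
    moreover have "(n + 1) div 2 = n div 2 + 1" using False by presburger
    ultimately show ?thesis using card_S by simp
  qed
qed

text \<open>Each full block contributes at most 3, and the remaining columns are bounded directly
  unless there is exactly one and it is full. The surplus element there is paid for by the preceding
  block, which exists because \<open>n \<ge> 2\<close>.\<close>

lemma card_le_triples:
  assumes "2 \<le> n"
  shows "card S \<le> 3 * (n div d) + min (n mod d) 3"
proof -
  define q r where "q = n div d" and "r = n mod d"
  have n: "n = q * d + r" and r: "r < d" using d_ge_2 by (auto simp: q_def r_def)
  have window: "columns a (a + d) \<le> 3" for a by (rule columns_le_3) simp
  have blocks: "columns 0 (p * d) \<le> 3 * p" for p
    by (rule columns_blocks_le) (rule window)
  have split: "card S \<le> columns 0 (q * d) + columns (q * d) n"
    using columns_split[of 0 "q * d" n] card_S n by simp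
  consider "r = 0" | "r = 1" | "r = 2" | "3 \<le> r" by linarith
  then have "card S \<le> 3 * q + min r 3"
  proof cases
    case 1
    then show ?thesis using blocks[of q] card_S n by simp
  next
    case 3
    then show ?thesis using blocks[of q] split two_columns_le_2[of "q * d"] n by simp
  next
    case 4
    then show ?thesis using blocks[of q] split columns_le_3[of n "q * d"] n r by simp
  next
    case 2
    then have n': "n = Suc (q * d)" using n by simp
    show ?thesis
    proof (cases "columns (q * d) n = 2")
      case False
      then show ?thesis
        using column_le_2[of "q * d"] blocks[of q] split n' 2 by simp
    next
      case True
      have "q \<noteq> 0" using n' assms by (cases q) auto
      then obtain p where p: "q = Suc p" by (cases q) auto
      \<comment> \<open>The full last column \<open>Suc (q * d)\<close> empties all but the first
        column of the preceding block, leaving at most 2 there: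
        \<open>3 * p + 2 + 2 = 3 * q + 1\<close>.\<close>
      have "\<not> (Suc (p * d) < fst v \<and> fst v \<le> q * d)" if "v \<in> S" for v
        using full_column_isolated[OF full_columnI[of "q * d"] that] True n' p by auto
      then have "columns (Suc (p * d)) (q * d) = 0" by (rule columns_eq_0I)
      moreover have "columns (p * d) (q * d)
          \<le> columns (p * d) (Suc (p * d)) + columns (Suc (p * d)) (q * d)"
        using p d_ge_2 by (intro columns_split) auto
      ultimately have "columns (p * d) (q * d) \<le> 2"
        using column_le_2[of "p * d"] by linarith
      then show ?thesis
        using split True blocks[of p] columns_split[of 0 "p * d" "q * d"] p 2 by simp
    qed
  qed
  then show ?thesis by (simp add: q_def r_def)
qed

end

section \<open>Extremal sets\<close>

text \<open>Chosen vertices in different columns are at least 2 apart, and a column has only two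
  vertices. So the two legs of an additive triple cannot both have length 1, and the total is at
  least 3.\<close>

lemma general_position_odd_columns:
  fixes n :: nat
  defines "S \<equiv> (\<lambda>k. 2 * k + 1) ` {..<(n + 1) div 2} \<times> {1, 2}"
  shows "general_position 3 2 (ladder n) S" and "card S = 2 * ((n + 1) div 2)"
proof -
  have "S \<subseteq> pverts (ladder n)" by (auto simp: S_def ladder_def)
  moreover have "2 < ladder_dist u w"
    if "u \<in> S" "v \<in> S" "w \<in> S" "u \<noteq> v" "v \<noteq> w" "u \<noteq> w"
      "ladder_dist u v + ladder_dist v w = ladder_dist u w" for u v w
  proof -
    have close: "x = y" if "ladder_dist (2 * x + 1, i) (2 * y + 1, j) \<le> 1" for x y i j
      using that by (cases x y rule: linorder_cases) auto
    have "0 < ladder_dist u v" "0 < ladder_dist v w"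
      using \<open>u \<noteq> v\<close> \<open>v \<noteq> w\<close> by (cases u; cases v; cases w; auto)+
    moreover obtain x i y j z k where eq: "u = (2 * x + 1, i)" "v = (2 * y + 1, j)" "w = (2 * z + 1, k)"
      "i \<in> {1, 2}" "j \<in> {1, 2}" "k \<in> {1, 2}"
      using \<open>u \<in> S\<close> \<open>v \<in> S\<close> \<open>w \<in> S\<close> by (auto simp: S_def)
    moreover have "\<not> (x = y \<and> y = z)"
      using eq \<open>u \<noteq> v\<close> \<open>v \<noteq> w\<close> \<open>u \<noteq> w\<close> by auto
    then have "\<not> (ladder_dist u v \<le> 1 \<and> ladder_dist v w \<le> 1)"
      using close eq by blast
    ultimately show ?thesis using that(7) by linarith
  qed
  ultimately show "general_position 3 2 (ladder n) S"
    unfolding ladder.general_position_3_iff by blast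
  show "card S = 2 * ((n + 1) div 2)"
    by (simp add: S_def card_cartesian_product card_image inj_on_def)
qed

definition zigzag_column :: "nat \<Rightarrow> nat \<Rightarrow> nat" where
  "zigzag_column d k = d * (k div 3) + k mod 3 + 1"

text \<open>The row follows the parity of \<open>k\<close> itself, not of its place in the block. As
  3 is odd, the pattern flips from block to block, so vertices \<open>k\<close> and
  \<open>k + 3\<close> are at distance \<open>d + 1\<close>.\<close>

definition zigzag :: "nat \<Rightarrow> nat \<Rightarrow> nat \<times> nat" where
  "zigzag d k = (zigzag_column d k, 1 + k mod 2)"

lemma zigzag_column_add_3: "zigzag_column d (k + 3) = zigzag_column d k + d"
  by (simp add: zigzag_column_def)

lemma strict_mono_zigzag_column:
  assumes "3 \<le> d"
  shows "strict_mono (zigzag_column d)"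
proof (rule strict_mono_Suc_iff[THEN iffD2], rule allI)
  fix k
  show "zigzag_column d k < zigzag_column d (Suc k)"
    using assms by (auto simp: zigzag_column_def div_Suc mod_Suc)
qed

lemma zigzag_column_le:
  assumes "3 \<le> d" and "k < 3 * (n div d) + min (n mod d) 3"
  shows "zigzag_column d k \<le> n"
proof -
  have n: "d * (n div d) + n mod d = n" by simp
  \<comment> \<open>Either \<open>k\<close> belongs to a complete block, or to the final partial one
    at an offset that still fits.\<close>
  have "k div 3 < q \<or> k div 3 = q \<and> k mod 3 < r" if "k < 3 * q + min r 3" for q r
    using that unfolding min_def by presburger
  then consider "k div 3 < n div d" | "k div 3 = n div d" "k mod 3 < n mod d"
    using assms(2) by blast
  then show ?thesis
  proof cases
    case 1
    then have "d * Suc (k div 3) \<le> d * (n div d)" by (intro mult_le_mono2) simp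
    moreover have "k mod 3 < 3" by simp
    ultimately show ?thesis using assms(1) n unfolding zigzag_column_def mult_Suc_right by linarith
  next
    case 2
    show ?thesis unfolding zigzag_column_def 2(1) using 2(2) n by linarith
  qed
qed

text \<open>The middle column lies strictly between the outer ones, so \<open>m \<ge> k + 2\<close>.
  For \<open>m = k + 2\<close> the middle vertex is in the opposite row and additivity fails; for
  \<open>m = k + 3\<close> the distance is \<open>d + 1\<close>; beyond that the columns alone
  differ by more than \<open>d\<close>.\<close>

lemma zigzag_triple:
  assumes d: "3 \<le> d" and ne: "k \<noteq> l" "l \<noteq> m" and "k < m"
    and add: "ladder_dist (zigzag d k) (zigzag d l) + ladder_dist (zigzag d l) (zigzag d m)
      = ladder_dist (zigzag d k) (zigzag d m)"
  shows "d < ladder_dist (zigzag d k) (zigzag d m)"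
proof -
  let ?c = "zigzag_column d"
  have less: "?c x < ?c y \<longleftrightarrow> x < y" for x y
    by (rule strict_mono_less[OF strict_mono_zigzag_column[OF d]])
  \<comment> \<open>Overshooting an end column costs at least 2 extra, while the row term of the
    direct distance makes up at most 1.\<close>
  have strictly_between: "b < a \<and> a < c"
    if "a \<noteq> b" "a \<noteq> c" "b < c"
      and "ladder_dist (b, i) (a, j) + ladder_dist (a, j) (c, h) = ladder_dist (b, i) (c, h)"
    for a b c i j h
  proof (rule ccontr)
    assume "\<not> (b < a \<and> a < c)"
    then have "a < b \<or> c < a" using that(1,2) by linarith
    then show False
      using that(3,4) by (elim disjE) (simp_all split: if_splits)
  qed
  have "?c l \<noteq> ?c k" "?c l \<noteq> ?c m" "?c k < ?c m"
    using ne \<open>k < m\<close> strict_mono_eq[OF strict_mono_zigzag_column[OF d]]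
    by (simp_all only: less) auto
  then have between: "?c k < ?c l" "?c l < ?c m"
    using strictly_between add unfolding zigzag_def by blast+
  then have l: "k < l" "l < m" by (simp_all only: less)
  consider "m = k + 2" | "m = k + 3" | "k + 3 < m" using l by linarith
  then show ?thesis
  proof cases
    case 1
    then have "l = k + 1" using l by simp
    have "1 + k mod 2 \<noteq> 1 + l mod 2" "1 + k mod 2 = 1 + m mod 2"
      unfolding 1 \<open>l = k + 1\<close> by presburger+
    with add between show ?thesis
      unfolding zigzag_def by simp
  next
    case 2
    have "1 + k mod 2 \<noteq> 1 + m mod 2" unfolding 2 by presburger
    moreover have "?c m = ?c k + d" unfolding 2 by (rule zigzag_column_add_3)
    ultimately show ?thesis unfolding zigzag_def by simp
  next
    case 3
    then have "?c (k + 3) < ?c m" by (simp add: less)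
    then have "?c k + d < ?c m" by (simp only: zigzag_column_add_3)
    then show ?thesis unfolding zigzag_def by simp
  qed
qed

lemma ladder_dist_commute: "ladder_dist u v = ladder_dist v u"
  by (cases u; cases v) auto

lemma general_position_zigzag:
  fixes d n :: nat
  assumes "3 \<le> d"
  defines "N \<equiv> 3 * (n div d) + min (n mod d) 3"
  shows "general_position 3 d (ladder n) (zigzag d ` {..<N})" and "card (zigzag d ` {..<N}) = N"
proof -
  have "zigzag d k \<in> pverts (ladder n)" if "k < N" for k
  proof -
    have "k mod 2 = 0 \<or> k mod 2 = 1" by presburger
    moreover have "1 \<le> zigzag_column d k" by (simp add: zigzag_column_def)
    moreover have "zigzag_column d k \<le> n"
      by (rule zigzag_column_le[OF assms(1) that[unfolded N_def]])
    ultimately show ?thesis unfolding zigzag_def ladder_def by auto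
  qed
  then have sub: "zigzag d ` {..<N} \<subseteq> pverts (ladder n)" by blast
  \<comment> \<open>Symmetry of the distance removes the assumption \<open>k < m\<close>.\<close>
  have triple: "d < ladder_dist (zigzag d k) (zigzag d m)"
    if "k \<noteq> l" "l \<noteq> m" "k \<noteq> m"
      "ladder_dist (zigzag d k) (zigzag d l) + ladder_dist (zigzag d l) (zigzag d m)
        = ladder_dist (zigzag d k) (zigzag d m)" for k l m
  proof (cases "k < m")
    case True
    show ?thesis by (rule zigzag_triple[OF assms(1) that(1,2) True that(4)])
  next
    case False
    then have "m < k" using that by simp
    moreover have "ladder_dist (zigzag d m) (zigzag d l) + ladder_dist (zigzag d l) (zigzag d k)
        = ladder_dist (zigzag d m) (zigzag d k)"
      using that(4) ladder_dist_commute[of "zigzag d m" "zigzag d l"]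
        ladder_dist_commute[of "zigzag d l" "zigzag d k"]
        ladder_dist_commute[of "zigzag d m" "zigzag d k"] by linarith
    ultimately have "d < ladder_dist (zigzag d m) (zigzag d k)"
      using zigzag_triple[OF assms(1)] that(1,2) by metis
    then show ?thesis by (subst ladder_dist_commute)
  qed
  have "d < ladder_dist u w"
    if mem: "u \<in> zigzag d ` {..<N}" "v \<in> zigzag d ` {..<N}" "w \<in> zigzag d ` {..<N}"
      and ne: "u \<noteq> v" "v \<noteq> w" "u \<noteq> w"
      and add: "ladder_dist u v + ladder_dist v w = ladder_dist u w" for u v w
  proof -
    obtain k l m where eq: "u = zigzag d k" "v = zigzag d l" "w = zigzag d m"
      using mem by (elim imageE)
    then have "k \<noteq> l" "l \<noteq> m" "k \<noteq> m" using ne by auto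
    from triple[OF this add[unfolded eq]] show ?thesis unfolding eq .
  qed
  with sub show "general_position 3 d (ladder n) (zigzag d ` {..<N})"
    unfolding ladder.general_position_3_iff by meson
  have "inj (zigzag d)"
  proof (rule injI)
    fix k l assume "zigzag d k = zigzag d l"
    then have "zigzag_column d k = zigzag_column d l" by (simp only: zigzag_def prod.inject)
    then show "k = l" by (simp only: strict_mono_eq[OF strict_mono_zigzag_column[OF assms(1)]])
  qed
  then show "card (zigzag d ` {..<N}) = N"
    by (simp add: card_image inj_on_subset)
qed

section \<open>The general position number\<close>

lemma gp_ladder_2: "gp 3 2 (ladder n) = 2 * ((n + 1) div 2)"
proof (rule gp_ladder_eqI[OF general_position_odd_columns])
  fix S assume "general_position 3 2 (ladder n) S"
  then interpret ladder_position 2 n S by unfold_locales simp_all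
  show "card S \<le> 2 * ((n + 1) div 2)" by (rule card_le_pairs)
qed

text \<open>No comparison of \<open>n\<close> with \<open>d\<close> is made, so this serves both
  parts of the theorem.\<close>

lemma gp_ladder_ge_3:
  assumes "3 \<le> d" and "2 \<le> n"
  shows "gp 3 d (ladder n) = 3 * (n div d) + min (n mod d) 3"
proof (rule gp_ladder_eqI[OF general_position_zigzag[OF assms(1)]])
  fix S assume "general_position 3 d (ladder n) S"
  then interpret ladder_position d n S using assms by unfold_locales simp_all
  show "card S \<le> 3 * (n div d) + min (n mod d) 3" by (rule card_le_triples[OF assms(2)])
qed

theorem theorem6p4:
  fixes d n :: nat
  assumes "d \<ge> 1" and "n \<ge> 1"
  shows "(n \<le> d \<longrightarrow>
            (n = 1 \<longrightarrow> gp 3 d (ladder n) = 2) \<and>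
            (n \<ge> 2 \<longrightarrow> gp 3 d (ladder n) = min n 3)) \<and>
         (n \<ge> d + 1 \<longrightarrow>
            (d = 2 \<longrightarrow> gp 3 d (ladder n) = 2 * (n div 2) + 2 * min (n mod 2) 1) \<and>
            (d \<ge> 3 \<longrightarrow> gp 3 d (ladder n) = 3 * (n div d) + min (n mod d) 3))"
proof (intro conjI impI)
  show "gp 3 d (ladder n) = 2" if "n = 1" using that gp_ladder_1 by simp
  show "gp 3 d (ladder n) = min n 3" if "n \<le> d" "n \<ge> 2"
  proof (cases "d = 2")
    case True
    then show ?thesis using that gp_ladder_2[of n] by simp
  next
    case False
    then have "gp 3 d (ladder n) = 3 * (n div d) + min (n mod d) 3"
      using that by (intro gp_ladder_ge_3) auto
    \<comment> \<open>For \<open>n < d\<close> the quotient is 0 and the remainder \<open>n\<close>;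
      for \<open>n = d\<close> they are 1 and 0, and \<open>d \<ge> 3\<close> makes the minimum
      3.\<close>
    then show ?thesis using that False by (cases "n = d") auto
  qed
  show "gp 3 d (ladder n) = 2 * (n div 2) + 2 * min (n mod 2) 1" if "d = 2"
  proof -
    \<comment> \<open>Both sides round \<open>n\<close> up to an even number.\<close>
    have "2 * ((n + 1) div 2) = 2 * (n div 2) + 2 * min (n mod 2) 1"
      by (cases "even n") (auto simp: odd_iff_mod_2_eq_one)
    then show ?thesis using that gp_ladder_2[of n] by simp
  qed
  show "gp 3 d (ladder n) = 3 * (n div d) + min (n mod d) 3" if "n \<ge> d + 1" "d \<ge> 3"
    using that by (intro gp_ladder_ge_3) auto
qed

end
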